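(* Let $\pi:\tilde X\to X$ be the minimal resolution of a germ of a normal surface singularity $(X,O)$ and let $A$ be the symmetric intersection matrix of the exceptional set. Assume that the singularity is like a star, i.e. the dual graph $\Gamma$ of the exceptional set is star-shaped with root $E_0$ and $s\ge3$ branches. For each branch $i=1,\dots,s$ let $q_i$ be the finite continued fraction $$q_i=a(i)_{1,1}-\cfrac{a(i)_{1,2}^2}{a(i)_{2,2}-\cfrac{a(i)_{2,3}^2}{a(i)_{3,3}-\cfrac{a(i)_{3,4}^2}{\cdots}}} .$$ Then $(NN)$ is true if the following conditions hold: (1) for every leaf $E_i$ of $\Gamma$, $C(A)_i<0$; (2) for every vertex $E_i$ which is not the root, $C(A)_i\le0$; (3) for all $i,j\in\{1,\dots,s\}$ with $i\ne j$, $$a_{0,0}+a_{0,i}+a_{0,j}-\sum_{k=1,\;k\ne i,j}^{s}\frac{a_{0,k}^2}{q_k}\le0 .$$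
   Context: Setting: $(X,O)$ is a germ of a normal surface singularity (over $\mathbb C$), $\pi:\tilde X\to X$ its minimal resolution, and $K_{\tilde X}$ the canonical divisor of $\tilde X$. The intersection matrix $A$ of the irreducible exceptional components (entry for two components $E,E'$: $E\cdot E'$) is symmetric, negative definite, with integer entries, negative diagonal and nonnegative off-diagonal entries. The dual graph $\Gamma$ has the exceptional components as vertices and an edge between two distinct components iff their intersection number is nonzero. A vertex is a leaf if it is connected to exactly one other vertex. For each vertex $E_i$, $C(A)_i$ is the sum of all entries of the row of $A$ corresponding to $E_i$ (diagonal entry included). Minimality gives $K_{\tilde X}\cdot E\ge0$ for each exceptional component $E$. Star-shaped with root $E_0$ and $s$ branches means: $\Gamma$ is a tree such that $\Gamma\setminus\{E_0\}$ is a disjoint union of $s$ chains (branches), each attached to $E_0$ by one of its end vertices. For the $i$-th branch, number its vertices $1,2,\dots,r_i$ going outward from the root; $a(i)_{p,q}$ is the intersection number of its $p$-th and $q$-th vertices (so $a(i)_{p,p}$ are self-intersections), and the continued fraction $q_i$ ends with $a(i)_{r_i,r_i}$. Also $a_{0,0}=E_0\cdot E_0$, and $a_{0,i}$ (for $i=1,\dots,s$) denotes the intersection number of $E_0$ with the first vertex of the $i$-th branch. For distinct exceptional components $E_i,E_j$, $(NN_{(i,j)})$ is the condition: there exist positive integers $n_k$, one for each exceptional component $E_k$, with $n_i<n_j$ such that $D=\sum_k n_kE_k$ satisfies $D\cdot E_k\le-2K_{\tilde X}\cdot E_k$ for all $k$. Condition $(NN)$ means that $(NN_{(i,j)})$ holds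 for all ordered pairs of distinct components. *)

theory Defs
  imports "HOL-Analysis.Analysis"
begin

text \<open>
  The libraries have no complex analytic surfaces, so the minimal resolution of a normal surface
  singularity enters through the numerical data of its exceptional set.
  The type \<open>'v\<close> indexes the irreducible exceptional components; \<open>A $ i $ j\<close> is
  the intersection number of the components \<open>i\<close> and \<open>j\<close>; \<open>K i\<close> is the degree of the
  canonical divisor on the component \<open>i\<close>; \<open>pa i\<close> is the arithmetic genus of that component
  (a natural number, since the component is an irreducible compact curve).
\<close>

definition dual_edge :: "int^'v^'v \<Rightarrow> 'v \<Rightarrow> 'v \<Rightarrow> bool" where
  "dual_edge A i j \<longleftrightarrow> i \<noteq> j \<and> A $ i $ j \<noteq> 0"

definition negative_definite :: "int^'v^'v \<Rightarrow> bool" where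
  "negative_definite A \<longleftrightarrow>
     (\<forall>x::real^'v. x \<noteq> 0 \<longrightarrow> x \<bullet> (map_matrix real_of_int A *v x) < 0)"

text \<open>
  The clause \<open>minimal\<close> says that there is no (-1)-curve: by Castelnuovo's criterion, a smooth
  rational component of self-intersection -1 (smooth rational means arithmetic genus 0) could be
  contracted. Together with adjunction it gives that the canonical divisor has nonnegative degree on
  every component. Conversely, by Grauert's contractibility criterion, all data satisfying the
  clauses below come from the minimal resolution of some normal surface singularity.
\<close>

locale minimal_resolution =
  fixes A :: "int^'v::finite^'v" and K :: "'v \<Rightarrow> int" and pa :: "'v \<Rightarrow> nat"
  assumes symmetric: "transpose A = A"
    and neg_def: "negative_definite A"
    and off_diagonal: "\<And>i j. i \<noteq> j \<Longrightarrow> 0 \<le> A $ i $ j"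
    and connected: "\<And>i j. (dual_edge A)\<^sup>*\<^sup>* i j"
    and adjunction: "\<And>i. A $ i $ i + K i = 2 * int (pa i) - 2"
    and minimal: "\<And>i. \<not> (pa i = 0 \<and> A $ i $ i = -1)"
begin

lemma diagonal_neg: "A $ i $ i < 0"
proof -
  let ?x = "axis i (1::real)"
  have "?x \<noteq> 0"
    by (simp add: axis_eq_0_iff)
  then have "?x \<bullet> (map_matrix real_of_int A *v ?x) < 0"
    using neg_def unfolding negative_definite_def by blast
  then show ?thesis
    by (simp add: inner_axis' matrix_vector_mul_component inner_axis)
qed

lemma canonical_degree_nonneg: "0 \<le> K i"
  using diagonal_neg[of i] adjunction[of i] minimal[of i] by (cases "pa i") auto

end

definition is_leaf :: "int^'v^'v \<Rightarrow> 'v \<Rightarrow> bool" where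
  "is_leaf A i \<longleftrightarrow> (\<exists>!j. dual_edge A i j)"

definition row_total :: "int^'v::finite^'v \<Rightarrow> 'v \<Rightarrow> int" where
  "row_total A i = (\<Sum>j\<in>UNIV. A $ i $ j)"

definition dual_tree :: "int^'v^'v \<Rightarrow> bool" where
  "dual_tree A \<longleftrightarrow>
     (\<forall>i j. (dual_edge A)\<^sup>*\<^sup>* i j) \<and>
     \<not> (\<exists>c. 3 \<le> length c \<and> distinct c \<and>
          (\<forall>p<length c. dual_edge A (c ! p) (c ! (Suc p mod length c))))"

definition is_chain :: "int^'v^'v \<Rightarrow> 'v list \<Rightarrow> bool" where
  "is_chain A c \<longleftrightarrow> c \<noteq> [] \<and> distinct c \<and>
     (\<forall>p<length c. \<forall>q<length c. dual_edge A (c ! p) (c ! q) \<longleftrightarrow> q = Suc p \<or> p = Suc q)"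

text \<open>
  The branches are \<open>br 1, \<dots>, br s\<close>, each listed going outward from the root, so that the entry
  \<open>p - 1\<close> of the list \<open>br i\<close> is the \<open>p\<close>-th vertex of the \<open>i\<close>-th branch.
\<close>

definition star_shaped :: "int^'v^'v \<Rightarrow> 'v \<Rightarrow> nat \<Rightarrow> (nat \<Rightarrow> 'v list) \<Rightarrow> bool" where
  "star_shaped A E0 s br \<longleftrightarrow>
     dual_tree A \<and>
     (\<Union>i\<in>{1..s}. set (br i)) = UNIV - {E0} \<and>
     (\<forall>i\<in>{1..s}. is_chain A (br i)) \<and>
     (\<forall>i\<in>{1..s}. \<forall>j\<in>{1..s}. i \<noteq> j \<longrightarrow>
        set (br i) \<inter> set (br j) = {} \<and>
        (\<forall>u\<in>set (br i). \<forall>v\<in>set (br j). \<not> dual_edge A u v)) \<and>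
     (\<forall>i\<in>{1..s}. \<forall>p<length (br i). dual_edge A E0 (br i ! p) \<longleftrightarrow> p = 0)"

text \<open>The value on the empty list is never used, since branches are nonempty.\<close>

fun cont_frac :: "int^'v^'v \<Rightarrow> 'v list \<Rightarrow> real" where
  "cont_frac A [] = 0"
| "cont_frac A [u] = real_of_int (A $ u $ u)"
| "cont_frac A (u # v # vs) =
     real_of_int (A $ u $ u) - (real_of_int (A $ u $ v))\<^sup>2 / cont_frac A (v # vs)"

text \<open>\<open>divisor_dot A n k\<close> is the intersection number of \<open>\<Sum>j. n j \<cdot> E\<^sub>j\<close> with \<open>E\<^sub>k\<close>.\<close>

definition divisor_dot :: "int^'v::finite^'v \<Rightarrow> ('v \<Rightarrow> int) \<Rightarrow> 'v \<Rightarrow> int" where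
  "divisor_dot A n k = (\<Sum>j\<in>UNIV. n j * A $ j $ k)"

definition NN_pair :: "int^'v::finite^'v \<Rightarrow> ('v \<Rightarrow> int) \<Rightarrow> 'v \<Rightarrow> 'v \<Rightarrow> bool" where
  "NN_pair A K i j \<longleftrightarrow>
     (\<exists>n. (\<forall>k. 0 < n k) \<and> n i < n j \<and> (\<forall>k. divisor_dot A n k \<le> - 2 * K k))"

definition NN :: "int^'v::finite^'v \<Rightarrow> ('v \<Rightarrow> int) \<Rightarrow> bool" where
  "NN A K \<longleftrightarrow> (\<forall>i j. i \<noteq> j \<longrightarrow> NN_pair A K i j)"

end

theory Submission
  imports Defs
begin

text \<open>
  For a component \<open>j\<close> let \<open>x\<close> be the real solution of \<open>A x = -e\<^sub>j\<close>; negative definiteness and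
  connectedness make it positive. Then \<open>j\<close> is the only place where \<open>x\<close> is maximal.
  Indeed, at a maximum \<open>v \<noteq> j\<close> off the root the row total must vanish and all neighbours of \<open>v\<close>
  are maxima as well, so the maximum spreads along the branch, either outward to a leaf, where the
  row total is negative, or, if \<open>j\<close> is in the way, inward to the root. At the root, eliminating the
  branches not containing \<open>j\<close> turns the equation \<open>(A x)\<^sub>0 = 0\<close> into one involving the continued
  fractions, and hypothesis (3) excludes a maximum there.
  Finally, with \<open>z\<close> solving \<open>A z = -(1, \<dots>, 1)\<close>, the integer vector \<open>\<lfloor>N x + c z\<rfloor>\<close> has the
  required properties for a constant \<open>c\<close> absorbing the rounding error and \<open>2 K\<close>, and for large \<open>N\<close>.
\<close>

section \<open>Continued fractions as elimination along a chain\<close>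

text \<open>Gaussian elimination from the outer end of the chain, with \<open>(w # c) ! p\<close> as
  the inner neighbour of \<open>c ! p\<close>. Positivity of \<open>x\<close> and nonzero edge
  entries keep every denominator nonzero, so no sign analysis of the continued fraction
  enters.\<close>

lemma cont_frac_three_term:
  fixes A :: "int^'v::finite^'v" and x :: "real^'v"
  assumes sym: "\<And>u v. A $ u $ v = A $ v $ u"
    and pos: "\<And>v. 0 < x $ v"
    and "c \<noteq> []"
    and "\<And>p. p < length c \<Longrightarrow> A $ ((w # c) ! p) $ (c ! p) \<noteq> 0"
    and "\<And>p. p < length c \<Longrightarrow>
      A $ (c ! p) $ ((w # c) ! p) * x $ ((w # c) ! p) + A $ (c ! p) $ (c ! p) * x $ (c ! p)
        + (if Suc p < length c then A $ (c ! p) $ (c ! Suc p) * x $ (c ! Suc p) else 0) = 0"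
  shows "cont_frac A c * x $ hd c = - (A $ w $ hd c * x $ w)"
  using assms(3-)
proof (induction c arbitrary: w rule: induct_list012)
  case 1
  then show ?case by simp
next
  case (2 u)
  show ?case using 2(3)[of 0] sym[of u w] by simp
next
  case (3 u v vs)
  have IH: "cont_frac A (v # vs) * x $ v = - (A $ u $ v * x $ u)"
    using "3.IH"(2)[of u] "3.prems"(2)[of "Suc _"] "3.prems"(3)[of "Suc _"] by fastforce
  have "A $ u $ v \<noteq> 0"
    using "3.prems"(2)[of 1] by simp
  then have "cont_frac A (v # vs) \<noteq> 0"
    using IH pos[of u] by force
  \<comment> \<open>This expresses the contribution of \<open>v\<close> to the row of
    \<open>u\<close> through \<open>x $ u\<close> alone; substituting it produces the next level of
    the fraction.\<close>
  then have "(A $ u $ v)\<^sup>2 / cont_frac A (v # vs) * x $ u = - (A $ u $ v * x $ v)"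
    using arg_cong[OF IH, of "\<lambda>t. A $ u $ v * t"] by (simp add: field_simps power2_eq_square)
  moreover have "A $ u $ w * x $ w + A $ u $ u * x $ u + A $ u $ v * x $ v = 0"
    using "3.prems"(3)[of 0] by simp
  ultimately show ?case
    using sym[of u w] by (simp add: algebra_simps)
qed

section \<open>Solvability, positivity and maximum principle\<close>

context minimal_resolution
begin

abbreviation AR :: "real^'v^'v" where "AR \<equiv> map_matrix real_of_int A"

lemma AR_mult_component: "(AR *v x) $ k = (\<Sum>j\<in>UNIV. A $ k $ j * x $ j)"
  by (simp add: matrix_vector_mult_def)

lemma entry_commute: "A $ i $ j = A $ j $ i"
  using symmetric by (metis transpose_def vec_lambda_beta)

lemma dual_edge_commute: "dual_edge A i j \<longleftrightarrow> dual_edge A j i"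
  by (auto simp: dual_edge_def entry_commute)

lemma AR_solvable: "\<exists>x. AR *v x = b"
proof -
  have "x = 0" if "AR *v x = 0" for x
    using neg_def that unfolding negative_definite_def by force
  then have "invertible AR"
    unfolding invertible_left_inverse matrix_left_invertible_ker by blast
  then obtain B where "AR ** B = mat 1"
    unfolding invertible_def by blast
  then have "AR *v (B *v b) = b"
    by (simp add: matrix_vector_mul_assoc)
  then show ?thesis ..
qed

text \<open>The negative part \<open>m\<close> and the positive part \<open>x + m\<close> have
  disjoint supports, so only off-diagonal entries enter their pairing, which is therefore
  nonnegative. Since \<open>m\<close> pairs nonpositively with \<open>AR *v x\<close>, the form at
  \<open>m\<close> would be nonnegative, against definiteness.\<close>

lemma AR_antinef_nonneg:
  assumes "\<And>k. (AR *v x) $ k \<le> 0"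
  shows "0 \<le> x $ k"
proof (rule ccontr)
  assume "\<not> 0 \<le> x $ k"
  define m where "m = (\<chi> k. max (- (x $ k)) 0)"
  have "m $ k \<noteq> 0"
    using \<open>\<not> 0 \<le> x $ k\<close> by (simp add: m_def)
  then have "m \<noteq> 0" by auto
  then have "m \<bullet> (AR *v m) < 0"
    using neg_def unfolding negative_definite_def by blast
  moreover have "m \<bullet> (AR *v x) \<le> 0"
    unfolding inner_vec_def
    by (intro sum_nonpos) (simp add: m_def assms mult_nonneg_nonpos)
  moreover have "0 \<le> m $ k * (A $ k $ j * (x + m) $ j)" for k j
    using off_diagonal[of k j] by (cases "k = j") (auto simp: m_def max_def)
  then have "0 \<le> m \<bullet> (AR *v (x + m))"
    unfolding inner_vec_def AR_mult_component
    by (auto simp: sum_distrib_left intro!: sum_nonneg)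
  ultimately show False
    by (simp add: matrix_vector_right_distrib inner_add_right)
qed

text \<open>At a zero of the nonnegative vector \<open>x\<close>, the row consists of nonnegative
  terms with nonpositive sum. Hence zeros propagate along edges, and connectedness would force
  \<open>x = 0\<close>.\<close>

lemma AR_antinef_pos:
  assumes antinef: "\<And>k. (AR *v x) $ k \<le> 0" and "x \<noteq> 0"
  shows "0 < x $ k"
proof (rule ccontr)
  note nonneg = AR_antinef_nonneg[OF antinef]
  assume "\<not> 0 < x $ k"
  then have "x $ k = 0"
    using nonneg[of k] by simp
  have step: "x $ w = 0" if "x $ v = 0" and "dual_edge A v w" for v w
  proof -
    have terms: "0 \<le> A $ v $ j * x $ j" for j
      using that(1) nonneg[of j] off_diagonal[of v j] by (cases "v = j") auto
    then have "(\<Sum>j\<in>UNIV. A $ v $ j * x $ j) = 0"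
      using antinef[of v] by (simp add: AR_mult_component sum_nonneg antisym)
    then have "A $ v $ w * x $ w = 0"
      using terms by (simp add: sum_nonneg_eq_0_iff)
    then show ?thesis
      using that(2) by (simp add: dual_edge_def)
  qed
  have "x $ w = 0" for w
    using connected[of k w] by induction (auto simp: \<open>x $ k = 0\<close> intro: step)
  then show False
    using \<open>x \<noteq> 0\<close> by (simp add: vec_eq_iff)
qed

text \<open>Discrete maximum principle: the gaps \<open>x $ v - x $ j\<close>, weighted by the row
  of \<open>v\<close>, are nonnegative terms, yet they sum to the row total times the positive value
  \<open>x $ v\<close>. So every term vanishes.\<close>

lemma harmonic_maximum:
  assumes "(AR *v x) $ v = 0" and "row_total A v \<le> 0"
    and max: "\<And>w. x $ w \<le> x $ v" and "0 < x $ v"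
  shows "row_total A v = 0" and "dual_edge A v w \<Longrightarrow> x $ w = x $ v"
proof -
  have terms: "0 \<le> A $ v $ j * (x $ v - x $ j)" for j
    using max[of j] off_diagonal[of v j] by (cases "v = j") auto
  have eq: "(\<Sum>j\<in>UNIV. A $ v $ j * (x $ v - x $ j)) = row_total A v * x $ v"
    using assms(1) unfolding AR_mult_component
    by (simp add: row_total_def right_diff_distrib sum_subtractf sum_distrib_right)
  have "0 \<le> row_total A v * x $ v"
    unfolding eq[symmetric] by (intro sum_nonneg terms)
  then show "row_total A v = 0"
    using assms(2,4) by (simp add: zero_le_mult_iff)
  then have "A $ v $ w * (x $ v - x $ w) = 0" for w
    using eq terms by (simp add: sum_nonneg_eq_0_iff)
  then show "dual_edge A v w \<Longrightarrow> x $ w = x $ v"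
    by (fastforce simp: dual_edge_def)
qed

section \<open>Rounding a real potential to an integral divisor\<close>

lemma NN_pair_if_potential:
  assumes x: "AR *v x = - axis j 1" and less: "x $ i < x $ j" and pos: "\<And>k. 0 < x $ k"
  shows "NN_pair A K i j"
proof -
  obtain z where z: "AR *v z = (\<chi> k. - 1)"
    using AR_solvable by blast
  \<comment> \<open>Rounding moves each coordinate by at most 1, which changes the intersection with
    component \<open>k\<close> by at most the absolute row sum; the other summand pays for
    \<open>2 * K k\<close>. The sum \<open>c\<close> is one bound for all \<open>k\<close>.\<close>
  define b where "b k = \<bar>2 * real_of_int (K k)\<bar> + (\<Sum>l\<in>UNIV. \<bar>real_of_int (A $ k $ l)\<bar>)" for k
  define c where "c = (\<Sum>k\<in>UNIV. b k)"
  have b_nonneg: "0 \<le> b k" for k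
    unfolding b_def by (intro add_nonneg_nonneg sum_nonneg) auto
  have b_le: "b k \<le> c" for k
    unfolding c_def by (rule member_le_sum) (auto simp: b_nonneg)
  have large: "\<forall>\<^sub>F N in at_top. r < N * d" if "0 < d" for r d :: real
    using eventually_gt_at_top[of "r / d"] by eventually_elim (use that in \<open>simp add: field_simps\<close>)
  \<comment> \<open>For \<open>y = N x + c z\<close> these say that \<open>y $ k > 1\<close> and
    \<open>y $ j - y $ i > 1\<close>, so positivity and the strict order survive taking
    floors.\<close>
  have "\<forall>\<^sub>F N in at_top. (\<forall>k\<in>UNIV. 1 - c * z $ k < N * x $ k) \<and>
      1 + c * (z $ i - z $ j) < N * (x $ j - x $ i) \<and> 0 \<le> N"
    by (intro eventually_conj eventually_ball_finite ballI large pos eventually_ge_at_top)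
      (use less in auto)
  then obtain N where N: "\<And>k. 1 - c * z $ k < N * x $ k"
    "1 + c * (z $ i - z $ j) < N * (x $ j - x $ i)" "0 \<le> N"
    using eventually_happens by fastforce
  define y where "y = N *\<^sub>R x + c *\<^sub>R z"
  define n where "n k = \<lfloor>y $ k\<rfloor>" for k
  have n_bounds: "n k \<le> y $ k" "y $ k - 1 < n k" for k
    unfolding n_def by linarith+
  have "0 < n k" for k
    using N(1)[of k] unfolding n_def y_def by simp
  moreover have "n i < n j"
  proof -
    have "y $ i < y $ j - 1"
      using N(2) by (simp add: y_def algebra_simps)
    then show ?thesis
      using n_bounds(1)[of i] n_bounds(2)[of j] by linarith
  qed
  moreover have "divisor_dot A n k \<le> - 2 * K k" for k
  proof -
    \<comment> \<open>The row value is \<open>- c\<close>, lowered by a further \<open>N\<close> at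
      \<open>k = j\<close>.\<close>
    have "(AR *v y) $ k \<le> - c"
      using N(3) by (simp add: y_def matrix_vector_right_distrib matrix_vector_mult_scaleR x z axis_def)
    moreover have "real_of_int (divisor_dot A n k) - (AR *v y) $ k
        = (\<Sum>l\<in>UNIV. A $ k $ l * (n l - y $ l))"
      by (simp add: divisor_dot_def AR_mult_component entry_commute[of _ k] right_diff_distrib
          sum_subtractf mult.commute)
    moreover have "\<dots> \<le> (\<Sum>l\<in>UNIV. \<bar>real_of_int (A $ k $ l)\<bar>)"
    proof (rule sum_mono)
      fix l
      have "A $ k $ l * (n l - y $ l) \<le> \<bar>real_of_int (A $ k $ l)\<bar> * \<bar>n l - y $ l\<bar>"
        by (simp add: abs_mult[symmetric] del: of_int_abs)
      also have "\<dots> \<le> \<bar>real_of_int (A $ k $ l)\<bar> * 1"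
        using n_bounds[of l] by (intro mult_left_mono) auto
      finally show "A $ k $ l * (n l - y $ l) \<le> \<bar>real_of_int (A $ k $ l)\<bar>"
        by simp
    qed
    moreover have "2 * K k + (\<Sum>l\<in>UNIV. \<bar>real_of_int (A $ k $ l)\<bar>) \<le> c"
      using b_le[of k] unfolding b_def by linarith
    ultimately have "real_of_int (divisor_dot A n k) \<le> real_of_int (- 2 * K k)"
      by simp
    then show ?thesis
      by linarith
  qed
  ultimately show ?thesis
    unfolding NN_pair_def by blast
qed

end

section \<open>Rows of the intersection matrix of a star\<close>

locale star_resolution = minimal_resolution A K pa
  for A :: "int^'v::finite^'v" and K :: "'v \<Rightarrow> int" and pa :: "'v \<Rightarrow> nat" +
  fixes E0 :: 'v and s :: nat and br :: "nat \<Rightarrow> 'v list"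
  assumes star: "star_shaped A E0 s br"
begin

lemma
  assumes "k \<in> {1..s}"
  shows branch_nonempty: "br k \<noteq> []"
    and branch_distinct: "distinct (br k)"
    and root_notin_branch: "E0 \<notin> set (br k)"
    and root_edge: "p < length (br k) \<Longrightarrow> dual_edge A E0 (br k ! p) \<longleftrightarrow> p = 0"
    and branch_edge: "p < length (br k) \<Longrightarrow> q < length (br k) \<Longrightarrow>
      dual_edge A (br k ! p) (br k ! q) \<longleftrightarrow> q = Suc p \<or> p = Suc q"
  using star assms unfolding star_shaped_def is_chain_def by blast+

lemma branch_cases:
  assumes "v \<noteq> E0"
  obtains k p where "k \<in> {1..s}" "p < length (br k)" "v = br k ! p"
  using star assms unfolding star_shaped_def by (metis DiffI UNIV_I UN_E in_set_conv_nth singletonD)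

lemma branch_unique:
  assumes "k \<in> {1..s}" "l \<in> {1..s}" "v \<in> set (br k)" "v \<in> set (br l)"
  shows "k = l"
  using star assms unfolding star_shaped_def by blast

lemma branch_neighbour:
  assumes k: "k \<in> {1..s}" and p: "p < length (br k)" and edge: "dual_edge A (br k ! p) w"
  shows "w = E0 \<and> p = 0 \<or> (\<exists>q<length (br k). w = br k ! q \<and> (q = Suc p \<or> p = Suc q))"
proof (cases "w = E0")
  case True
  then show ?thesis
    using root_edge[OF k p] edge dual_edge_commute by blast
next
  case False
  then obtain l q where l: "l \<in> {1..s}" and q: "q < length (br l)" and w: "w = br l ! q"
    by (rule branch_cases)
  have "l = k"
  proof (rule ccontr)
    assume "l \<noteq> k"
    then show False
      using star k l p q edge unfolding w star_shaped_def by (metis nth_mem)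
  qed
  then show ?thesis
    using q w branch_edge[OF k p] edge by blast
qed

text \<open>Prepending the root shifts indices by one, so \<open>(E0 # br k) ! p\<close> is the
  neighbour of \<open>br k ! p\<close> on the root side, namely the root itself for
  \<open>p = 0\<close>.\<close>

lemma branch_pred_edge:
  assumes "k \<in> {1..s}" "p < length (br k)"
  shows "dual_edge A (br k ! p) ((E0 # br k) ! p)"
  using assms root_edge[of k p] branch_edge[of k p "p - 1"] dual_edge_commute
  by (cases p) auto

lemma branch_end_leaf:
  assumes k: "k \<in> {1..s}" and p: "Suc p = length (br k)"
  shows "is_leaf A (br k ! p)"
  unfolding is_leaf_def
proof (rule ex1I)
  show "dual_edge A (br k ! p) ((E0 # br k) ! p)"
    using k p by (intro branch_pred_edge) auto
  show "w = (E0 # br k) ! p" if "dual_edge A (br k ! p) w" for w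
    using branch_neighbour[OF k _ that] p by auto
qed

text \<open>The root meets only the branch heads, which are distinct because the branches are
  disjoint.\<close>

lemma root_row:
  "(AR *v x) $ E0 = A $ E0 $ E0 * x $ E0 + (\<Sum>k\<in>{1..s}. A $ E0 $ hd (br k) * x $ hd (br k))"
proof -
  let ?h = "\<lambda>k. hd (br k)"
  have hd_in: "?h k \<in> set (br k)" if "k \<in> {1..s}" for k
    using branch_nonempty[OF that] by simp
  have inj: "inj_on ?h {1..s}"
  proof (rule inj_onI)
    show "k = l" if "k \<in> {1..s}" "l \<in> {1..s}" "?h k = ?h l" for k l
      using branch_unique[OF that(1,2) hd_in[OF that(1)]] hd_in[OF that(2)] that(3) by simp
  qed
  have root: "E0 \<notin> ?h ` {1..s}"
  proof
    assume "E0 \<in> ?h ` {1..s}"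
    then obtain k where "k \<in> {1..s}" "E0 = ?h k"
      by blast
    then show False
      using root_notin_branch[of k] hd_in[of k] by simp
  qed
  have zero: "A $ E0 $ v = 0" if "v \<notin> insert E0 (?h ` {1..s})" for v
  proof (rule ccontr)
    assume "A $ E0 $ v \<noteq> 0"
    then have "dual_edge A E0 v"
      using that by (auto simp: dual_edge_def)
    moreover from that have "v \<noteq> E0"
      by blast
    then obtain k p where "k \<in> {1..s}" "p < length (br k)" "v = br k ! p"
      by (rule branch_cases)
    ultimately have "v = ?h k"
      using root_edge[of k p] branch_nonempty[of k] by (simp add: hd_conv_nth)
    then show False
      using that \<open>k \<in> {1..s}\<close> by blast
  qed
  have "(AR *v x) $ E0 = (\<Sum>v\<in>insert E0 (?h ` {1..s}). A $ E0 $ v * x $ v)"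
    unfolding AR_mult_component by (rule sum.mono_neutral_right) (auto simp: zero)
  also have "\<dots> = A $ E0 $ E0 * x $ E0 + (\<Sum>v\<in>?h ` {1..s}. A $ E0 $ v * x $ v)"
    using root by simp
  finally show ?thesis
    unfolding sum.reindex[OF inj] by simp
qed

text \<open>Along a branch preceded by the root the matrix is tridiagonal; the row is written in the
  shape that \<open>cont_frac_three_term\<close> expects.\<close>

lemma branch_row:
  assumes k: "k \<in> {1..s}" and p: "p < length (br k)"
  defines "c \<equiv> br k"
  shows "(AR *v x) $ (c ! p) = A $ (c ! p) $ ((E0 # c) ! p) * x $ ((E0 # c) ! p)
    + A $ (c ! p) $ (c ! p) * x $ (c ! p)
    + (if Suc p < length c then A $ (c ! p) $ (c ! Suc p) * x $ (c ! Suc p) else 0)"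
proof -
  let ?u = "c ! p" and ?w = "(E0 # c) ! p"
  let ?N = "if Suc p < length c then {c ! Suc p} else {}"
  have "distinct (E0 # c)"
    using root_notin_branch[OF k] branch_distinct[OF k] by (simp add: c_def)
  then have dist: "(E0 # c) ! i = (E0 # c) ! j \<longleftrightarrow> i = j" if "i \<le> length c" "j \<le> length c" for i j
    using that by (intro nth_eq_iff_index_eq) auto
  have "?u \<noteq> ?w" "Suc p < length c \<Longrightarrow> c ! Suc p \<noteq> ?w" "Suc p < length c \<Longrightarrow> c ! Suc p \<noteq> ?u"
    using dist[of "Suc p" p] dist[of "Suc (Suc p)" p] dist[of "Suc (Suc p)" "Suc p"] p
    by (auto simp: c_def)
  moreover have "A $ ?u $ v = 0" if "v \<notin> {?w, ?u} \<union> ?N" for v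
  proof (rule ccontr)
    assume "A $ ?u $ v \<noteq> 0"
    then have "dual_edge A ?u v"
      using that by (auto simp: dual_edge_def)
    then show False
      using branch_neighbour[OF k p, of v] that by (auto simp: c_def)
  qed
  then have "(AR *v x) $ ?u = (\<Sum>v\<in>{?w, ?u} \<union> ?N. A $ ?u $ v * x $ v)"
    unfolding AR_mult_component by (intro sum.mono_neutral_right) auto
  ultimately show ?thesis
    by (auto simp: algebra_simps)
qed

text \<open>A Schur complement: a branch on which \<open>AR *v x\<close> vanishes can be eliminated
  from the root row, leaving a multiple of \<open>x $ E0\<close> with the coefficient occurring in
  hypothesis (3).\<close>

lemma branch_cont_frac:
  assumes k: "k \<in> {1..s}" and pos: "\<And>v. 0 < x $ v"
    and harmonic: "\<And>v. v \<in> set (br k) \<Longrightarrow> (AR *v x) $ v = 0"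
  shows "A $ E0 $ hd (br k) * x $ hd (br k)
    = - ((real_of_int (A $ E0 $ hd (br k)))\<^sup>2 / cont_frac A (br k) * x $ E0)"
proof -
  let ?a = "real_of_int (A $ E0 $ hd (br k))"
  have eq: "cont_frac A (br k) * x $ hd (br k) = - (?a * x $ E0)"
  proof (rule cont_frac_three_term)
    show "br k \<noteq> []" "A $ u $ v = A $ v $ u" "0 < x $ v" for u v
      using branch_nonempty[OF k] by (simp_all add: entry_commute pos)
    show "A $ ((E0 # br k) ! p) $ (br k ! p) \<noteq> 0" if "p < length (br k)" for p
      using branch_pred_edge[OF k that] by (simp add: dual_edge_def entry_commute)
  qed (use harmonic in \<open>simp add: branch_row[OF k, symmetric]\<close>)
  have "?a \<noteq> 0"
    using root_edge[OF k, of 0] branch_nonempty[OF k] by (simp add: dual_edge_def hd_conv_nth)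
  then have "cont_frac A (br k) \<noteq> 0"
    using eq pos[of E0] by force
  then show ?thesis
    using arg_cong[OF eq, of "\<lambda>t. ?a * t"] by (simp add: field_simps power2_eq_square)
qed

end

section \<open>Locating the maximum of the potential\<close>

locale star_criterion = star_resolution +
  assumes branches: "3 \<le> s"
    and leaves: "\<And>v. is_leaf A v \<Longrightarrow> row_total A v < 0"
    and non_root: "\<And>v. v \<noteq> E0 \<Longrightarrow> row_total A v \<le> 0"
    and at_root: "\<And>i j. i \<in> {1..s} \<Longrightarrow> j \<in> {1..s} \<Longrightarrow> i \<noteq> j \<Longrightarrow>
      real_of_int (A $ E0 $ E0) + real_of_int (A $ E0 $ hd (br i))
        + real_of_int (A $ E0 $ hd (br j))
        - (\<Sum>k\<in>{1..s} - {i, j}. (real_of_int (A $ E0 $ hd (br k)))\<^sup>2 / cont_frac A (br k)) \<le> 0"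
begin

text \<open>The maximum moves outward to the leaf, where the maximum principle demands row total 0.
  Only positions from \<open>p\<close> on must be harmonic, so the source may lie on the same branch
  nearer to the root.\<close>

lemma no_maximum_outward_harmonic:
  assumes k: "k \<in> {1..s}" and "p < length (br k)"
    and pos: "\<And>v. 0 < x $ v" and max: "\<And>w. x $ w \<le> x $ (br k ! p)"
    and harmonic: "\<And>q. p \<le> q \<Longrightarrow> q < length (br k) \<Longrightarrow> (AR *v x) $ (br k ! q) = 0"
  shows False
  using assms(2,4,5)
proof (induction "length (br k) - p" arbitrary: p rule: less_induct)
  case less
  have nonpos: "row_total A (br k ! p) \<le> 0"
    using root_notin_branch[OF k] nth_mem[OF less.prems(1)] by (intro non_root) auto
  note maximum = harmonic_maximum[OF less.prems(3)[OF order_refl less.prems(1)] nonpos less.prems(2) pos]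
  show False
  proof (cases "Suc p = length (br k)")
    case True
    then show False
      using leaves[OF branch_end_leaf[OF k True]] maximum(1) by simp
  next
    case False
    then have q: "Suc p < length (br k)"
      using less.prems(1) by simp
    then have "x $ (br k ! Suc p) = x $ (br k ! p)"
      using maximum(2) branch_edge[OF k less.prems(1) q] by blast
    then show False
      using less.hyps[of "Suc p"] less.prems q by (simp add: diff_less_mono2)
  qed
qed

text \<open>The inward counterpart, for a source lying farther out than \<open>p\<close> on the same
  branch.\<close>

lemma maximum_spreads_to_root:
  assumes k: "k \<in> {1..s}" and "p < length (br k)"
    and pos: "\<And>v. 0 < x $ v" and max: "\<And>w. x $ w \<le> x $ (br k ! p)"
    and harmonic: "\<And>q. q \<le> p \<Longrightarrow> (AR *v x) $ (br k ! q) = 0"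
  shows "x $ (br k ! p) = x $ E0"
  using assms(2,4,5)
proof (induction p)
  case 0
  have "row_total A (br k ! 0) \<le> 0"
    using root_notin_branch[OF k] nth_mem[OF 0(1)] by (intro non_root) auto
  then show ?case
    using harmonic_maximum(2)[OF 0(3)[OF order_refl] _ 0(2) pos] branch_pred_edge[OF k 0(1)] by simp
next
  case (Suc p)
  have "row_total A (br k ! Suc p) \<le> 0"
    using root_notin_branch[OF k] nth_mem[OF Suc.prems(1)] by (intro non_root) auto
  then have "x $ (br k ! p) = x $ (br k ! Suc p)"
    using harmonic_maximum(2)[OF Suc.prems(3)[OF order_refl] _ Suc.prems(2) pos]
      branch_pred_edge[OF k Suc.prems(1)] by simp
  then show ?case
    using Suc by simp
qed

text \<open>Branch \<open>i\<close> may contain the source. A second branch \<open>j\<close>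
  supplies a strict inequality, and all remaining branches are eliminated exactly, which makes the
  left side of hypothesis (3) positive.\<close>

lemma no_maximum_at_root:
  assumes i: "i \<in> {1..s}" and pos: "\<And>v. 0 < x $ v" and max: "\<And>w. x $ w \<le> x $ E0"
    and harmonic: "\<And>v. v \<notin> set (br i) \<Longrightarrow> (AR *v x) $ v = 0"
  shows False
proof -
  let ?a = "\<lambda>k. real_of_int (A $ E0 $ hd (br k))"
  let ?f = "\<lambda>k. ?a k * x $ hd (br k)"
  have "\<exists>j\<in>{1..s}. j \<noteq> i"
    using branches by (intro bexI[of _ "if i = 1 then 2 else 1"]) auto
  then obtain j where j: "j \<in> {1..s}" "i \<noteq> j"
    by blast
  have other: "(AR *v x) $ v = 0" if "k \<in> {1..s}" "k \<noteq> i" "v \<in> set (br k)" for k v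
    using branch_unique i that by (intro harmonic) blast
  have a_pos: "0 < ?a k" if "k \<in> {1..s}" for k
    using root_edge[OF that, of 0] branch_nonempty[OF that] off_diagonal[of E0 "hd (br k)"]
    by (simp add: dual_edge_def hd_conv_nth less_le)
  \<comment> \<open>Equality would put a maximum at the head of a wholly harmonic branch, from where
    it would spread to the leaf.\<close>
  have "x $ hd (br j) < x $ E0"
  proof (rule ccontr)
    assume "\<not> x $ hd (br j) < x $ E0"
    then have "x $ w \<le> x $ (br j ! 0)" for w
      using max[of w] branch_nonempty[OF j(1)] by (simp add: hd_conv_nth)
    then show False
      using no_maximum_outward_harmonic[OF j(1) _ pos, of 0] branch_nonempty[OF j(1)] other j
      by simp
  qed
  then have fj: "?f j < ?a j * x $ E0"
    using a_pos[OF j(1)] by simp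
  have fi: "?f i \<le> ?a i * x $ E0"
    using a_pos[OF i] max by simp
  have rest: "sum ?f ({1..s} - {i, j})
      = - ((\<Sum>k\<in>{1..s} - {i, j}. (?a k)\<^sup>2 / cont_frac A (br k)) * x $ E0)"
    unfolding sum_distrib_right sum_negf[symmetric]
    using branch_cont_frac[OF _ pos] other by (intro sum.cong) auto
  \<comment> \<open>The source lies off the root, so the root row vanishes; the summands for
    \<open>i\<close> and \<open>j\<close> are estimated, the others replaced by
    \<open>rest\<close>.\<close>
  have "0 = A $ E0 $ E0 * x $ E0 + sum ?f {1..s}"
    using root_row[of x] harmonic[OF root_notin_branch[OF i]] by simp
  also have "sum ?f {1..s} = ?f i + ?f j + sum ?f ({1..s} - {i, j})"
  proof -
    have "{1..s} = insert i (insert j ({1..s} - {i, j}))"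
      using i j by auto
    then have "sum ?f {1..s} = sum ?f (insert i (insert j ({1..s} - {i, j})))"
      by simp
    then show ?thesis
      using j(2) by simp
  qed
  finally have "0 < (A $ E0 $ E0 + ?a i + ?a j
      - (\<Sum>k\<in>{1..s} - {i, j}. (?a k)\<^sup>2 / cont_frac A (br k))) * x $ E0"
    using fi fj rest by (simp add: algebra_simps)
  then show False
    using at_root[OF i j] pos[of E0] by (simp add: zero_less_mult_iff)
qed

lemma maximum_unique:
  assumes x: "AR *v x = - axis j 1" and pos: "\<And>v. 0 < x $ v" and max: "\<And>w. x $ w \<le> x $ v"
  shows "v = j"
proof (rule ccontr)
  assume "v \<noteq> j"
  have harmonic: "(AR *v x) $ w = 0" if "w \<noteq> j" for w
    using that by (simp add: x axis_def)
  have root: "v \<noteq> E0"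
  proof
    assume "v = E0"
    then have "j \<noteq> E0"
      using \<open>v \<noteq> j\<close> by simp
    then obtain i q where "i \<in> {1..s}" "q < length (br i)" "j = br i ! q"
      by (rule branch_cases)
    then show False
      using no_maximum_at_root[of i x] pos max \<open>v = E0\<close> harmonic by (metis nth_mem)
  qed
  then obtain k p where k: "k \<in> {1..s}" and p: "p < length (br k)" and v: "v = br k ! p"
    by (rule branch_cases)
  show False
  \<comment> \<open>If \<open>j\<close> lies farther out on the branch of \<open>v\<close>, the part
    from \<open>v\<close> inward is harmonic; otherwise the part from \<open>v\<close> outward is,
    including when \<open>j\<close> is the root.\<close>
  proof (cases "\<exists>q>p. q < length (br k) \<and> j = br k ! q")
    case True
    then obtain q where q: "p < q" "q < length (br k)" "j = br k ! q"
      by blast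
    then have "br k ! q' \<noteq> j" if "q' \<le> p" for q'
      using that branch_distinct[OF k] by (simp add: nth_eq_iff_index_eq)
    then have "x $ v = x $ E0"
      unfolding v using maximum_spreads_to_root[OF k p pos] max harmonic v by blast
    moreover have "j \<in> set (br k)"
      using q by simp
    ultimately show False
      using no_maximum_at_root[OF k pos] max harmonic by metis
  next
    case False
    then have "br k ! q \<noteq> j" if "p \<le> q" "q < length (br k)" for q
      using that \<open>v \<noteq> j\<close> v by (metis le_neq_implies_less)
    then show False
      using no_maximum_outward_harmonic[OF k p pos] max harmonic v by blast
  qed
qed

lemma NN_holds: "NN A K"
  unfolding NN_def
proof (intro allI impI)
  fix i j :: 'a
  assume "i \<noteq> j"
  obtain x where x: "AR *v x = - axis j 1"
    using AR_solvable by blast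
  have "x \<noteq> 0"
    using x by (auto simp: axis_eq_0_iff)
  then have pos: "0 < x $ v" for v
    using x by (intro AR_antinef_pos) (auto simp: axis_def)
  obtain v where v: "\<And>w. x $ w \<le> x $ v"
  proof -
    have "Max (range (($) x)) \<in> range (($) x)"
      by (intro Max_in) auto
    then obtain v where "Max (range (($) x)) = x $ v"
      by blast
    then show ?thesis
      using that[of v] by (metis Max_ge finite finite_imageI rangeI)
  qed
  have "v = j"
    using maximum_unique[OF x pos v] .
  \<comment> \<open>Equality would make \<open>i\<close> a second maximum.\<close>
  moreover have "x $ i \<noteq> x $ j"
  proof
    assume "x $ i = x $ j"
    then show False
      using maximum_unique[OF x pos, of i] v \<open>v = j\<close> \<open>i \<noteq> j\<close> by simp
  qed
  ultimately have "x $ i < x $ j"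
    using v[of i] by simp
  then show "NN_pair A K i j"
    by (rule NN_pair_if_potential[OF x _ pos])
qed

end

theorem theorem8:
  fixes A :: "int^'v::finite^'v" and K :: "'v \<Rightarrow> int" and pa :: "'v \<Rightarrow> nat"
    and E0 :: 'v and s :: nat and br :: "nat \<Rightarrow> 'v list"
  assumes resolution: "minimal_resolution A K pa"
    and star: "star_shaped A E0 s br"
    and branches: "3 \<le> s"
    and leaves: "\<And>v. is_leaf A v \<Longrightarrow> row_total A v < 0"
    and non_root: "\<And>v. v \<noteq> E0 \<Longrightarrow> row_total A v \<le> 0"
    and at_root: "\<And>i j. i \<in> {1..s} \<Longrightarrow> j \<in> {1..s} \<Longrightarrow> i \<noteq> j \<Longrightarrow>
      real_of_int (A $ E0 $ E0) + real_of_int (A $ E0 $ hd (br i))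
        + real_of_int (A $ E0 $ hd (br j))
        - (\<Sum>k\<in>{1..s} - {i, j}. (real_of_int (A $ E0 $ hd (br k)))\<^sup>2 / cont_frac A (br k)) \<le> 0"
  shows "NN A K"
proof -
  interpret minimal_resolution A K pa
    by (fact resolution)
  interpret star_criterion A K pa E0 s br
    by unfold_locales (fact star branches leaves non_root at_root)+
  show ?thesis
    by (fact NN_holds)
qed

end
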